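(* Let $G:\mathbb B^2\to\mathbb C^2$ be an autonomous Herglotz vector field associated with the class $\mathcal M$ (i.e. $-G\in\mathcal M$), with power series expansion $$G(z_1,z_2)=\Big(-z_1+\sum_{\alpha\in\mathbb N^2,\,|\alpha|\ge 2}q^1_\alpha z^\alpha,\ -z_2+\sum_{\alpha\in\mathbb N^2,\,|\alpha|\ge 2}q^2_\alpha z^\alpha\Big)$$ at the origin. For every $v=(v_1,v_2)\in\mathbb C^2$ with $\|v\|=1$, the function $p_v:\mathbb D\to\mathbb C$ defined by $$-\zeta\,p_v(\zeta)=\langle G(\zeta v),v\rangle,\qquad \zeta\in\mathbb D,$$ belongs to the Carathéodory class and has the expansion $$p_v(\zeta)=1-\sum_{m=1}^\infty\Big(\sum_{|\alpha|=m+1}(q^1_\alpha\overline{v_1}+q^2_\alpha\overline{v_2})v^\alpha\Big)\zeta^m .$$ In particular, for every integer $m\ge 1$, $$\sup_{\|v\|=1}\Big|\sum_{|\alpha|=m+1}(q^1_\alpha\overline{v_1}+q^2_\alpha\overline{v_2})v^\alpha\Big|\le 2.$$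
   Context: $\mathbb B^2\subset\mathbb C^2$ is the open Euclidean unit ball, $\mathbb D\subset\mathbb C$ is the open unit disc, $\langle\cdot,\cdot\rangle$ is the standard Hermitian inner product, $\langle z,w\rangle=z_1\overline{w_1}+z_2\overline{w_2}$, with norm $\|\cdot\|$, and $\mathbb N$ is the set of nonnegative integers. For $\alpha=(\alpha_1,\alpha_2)\in\mathbb N^2$, $|\alpha|=\alpha_1+\alpha_2$ and $z^\alpha=z_1^{\alpha_1}z_2^{\alpha_2}$. The class $\mathcal M$ is the set of holomorphic maps $h:\mathbb B^2\to\mathbb C^2$ such that $h(0)=0$, $dh_0=\mathrm{id}$, and $\mathrm{Re}\,\langle h(z),z\rangle>0$ for all $z\in\mathbb B^2\setminus\{0\}$. An autonomous Herglotz vector field associated with the class $\mathcal M$ on $\mathbb B^2$ is a (time-independent) holomorphic map $G:\mathbb B^2\to\mathbb C^2$ with $-G\in\mathcal M$. The Carathéodory class is the set of holomorphic functions $p:\mathbb D\to\mathbb C$ with $p(0)=1$ and $\mathrm{Re}\,p(\zeta)>0$ for all $\zeta\in\mathbb D$. The value of $p_v$ at $\zeta=0$ is understood by holomorphic extension. *)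

theory Defs
  imports "HOL-Complex_Analysis.Complex_Analysis"
begin

definition cinner2 :: "complex ^ 2 \<Rightarrow> complex ^ 2 \<Rightarrow> complex" where
  "cinner2 z w = z $ 1 * cnj (w $ 1) + z $ 2 * cnj (w $ 2)"

abbreviation unit_ball2 :: "(complex ^ 2) set" where
  "unit_ball2 \<equiv> ball 0 1"

abbreviation unit_disc :: "complex set" where
  "unit_disc \<equiv> ball 0 1"

text \<open>Holomorphy in several variables: the real Frechet derivative exists at every point
  and is complex linear. It is only meant for open sets, since the derivative is taken in a
  full neighbourhood of each point.\<close>

definition holomorphic_map_on :: "(complex ^ 2 \<Rightarrow> complex ^ 2) \<Rightarrow> (complex ^ 2) set \<Rightarrow> bool" where
  "holomorphic_map_on h S \<longleftrightarrow>
     (\<forall>z\<in>S. \<exists>D. (h has_derivative D) (at z) \<and> (\<forall>c x. D (c *s x) = c *s D x))"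

definition class_M :: "(complex ^ 2 \<Rightarrow> complex ^ 2) set" where
  "class_M = {h. holomorphic_map_on h unit_ball2 \<and> h 0 = 0 \<and> (h has_derivative id) (at 0) \<and>
                 (\<forall>z\<in>unit_ball2 - {0}. Re (cinner2 (h z) z) > 0)}"

definition autonomous_herglotz :: "(complex ^ 2 \<Rightarrow> complex ^ 2) \<Rightarrow> bool" where
  "autonomous_herglotz G \<longleftrightarrow> holomorphic_map_on G unit_ball2 \<and> (\<lambda>z. - G z) \<in> class_M"

definition caratheodory_class :: "(complex \<Rightarrow> complex) set" where
  "caratheodory_class =
     {p. p holomorphic_on unit_disc \<and> p 0 = 1 \<and> (\<forall>\<zeta>\<in>unit_disc. Re (p \<zeta>) > 0)}"

type_synonym multi_index = "nat \<times> nat"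

definition mi_deg :: "multi_index \<Rightarrow> nat" where
  "mi_deg \<alpha> = fst \<alpha> + snd \<alpha>"

definition mi_pow :: "complex ^ 2 \<Rightarrow> multi_index \<Rightarrow> complex" where
  "mi_pow z \<alpha> = (z $ 1) ^ fst \<alpha> * (z $ 2) ^ snd \<alpha>"

text \<open>The expansion at the origin is only required to hold on some neighbourhood of the origin;
  sums over multi-indices are unconditional.\<close>

definition herglotz_expansion ::
    "(complex ^ 2 \<Rightarrow> complex ^ 2) \<Rightarrow> (multi_index \<Rightarrow> complex) \<Rightarrow> (multi_index \<Rightarrow> complex) \<Rightarrow> bool" where
  "herglotz_expansion G q1 q2 \<longleftrightarrow>
     (\<forall>\<^sub>F z in nhds 0.
        (\<lambda>\<alpha>. q1 \<alpha> * mi_pow z \<alpha>) summable_on {\<alpha>. mi_deg \<alpha> \<ge> 2} \<and>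
        (\<lambda>\<alpha>. q2 \<alpha> * mi_pow z \<alpha>) summable_on {\<alpha>. mi_deg \<alpha> \<ge> 2} \<and>
        G z $ 1 = - z $ 1 + (\<Sum>\<^sub>\<infinity>\<alpha>\<in>{\<alpha>. mi_deg \<alpha> \<ge> 2}. q1 \<alpha> * mi_pow z \<alpha>) \<and>
        G z $ 2 = - z $ 2 + (\<Sum>\<^sub>\<infinity>\<alpha>\<in>{\<alpha>. mi_deg \<alpha> \<ge> 2}. q2 \<alpha> * mi_pow z \<alpha>))"

text \<open>The function \<open>p\<^sub>v\<close> solving \<open>- \<zeta> p\<^sub>v(\<zeta>) = \<langle>G(\<zeta>v), v\<rangle>\<close>; its value at \<open>0\<close> is the limit there,
  i.e. the value of the holomorphic extension.\<close>

definition slice_fun :: "(complex ^ 2 \<Rightarrow> complex ^ 2) \<Rightarrow> complex ^ 2 \<Rightarrow> complex \<Rightarrow> complex" where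
  "slice_fun G v \<zeta> =
     (if \<zeta> = 0 then Lim (at 0) (\<lambda>\<xi>. - cinner2 (G (\<xi> *s v)) v / \<xi>)
      else - cinner2 (G (\<zeta> *s v)) v / \<zeta>)"

definition slice_coeff ::
    "(multi_index \<Rightarrow> complex) \<Rightarrow> (multi_index \<Rightarrow> complex) \<Rightarrow> complex ^ 2 \<Rightarrow> nat \<Rightarrow> complex" where
  "slice_coeff q1 q2 v m =
     (\<Sum>\<alpha> | mi_deg \<alpha> = m + 1. (q1 \<alpha> * cnj (v $ 1) + q2 \<alpha> * cnj (v $ 2)) * mi_pow v \<alpha>)"

lemma finite_mi_deg_eq: "finite {\<alpha>. mi_deg \<alpha> = n}"
proof (rule finite_subset)
  show "{\<alpha>. mi_deg \<alpha> = n} \<subseteq> {..n} \<times> {..n}"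
    by (auto simp: mi_deg_def)
qed auto

end

theory Submission
  imports Defs
begin

text \<open>
  Restricting \<open>- G\<close> to the complex line through a unit vector \<open>v\<close> and pairing it with \<open>v\<close> gives
  a holomorphic function \<open>g\<close> on the disc with \<open>g 0 = 0\<close> and \<open>g' 0 = \<langle>v, v\<rangle> = 1\<close>, so that
  \<open>p\<^sub>v = g / \<zeta>\<close> extends holomorphically with value \<open>1\<close> at \<open>0\<close>. As
  \<open>\<langle>- G (\<zeta> v), \<zeta> v\<rangle> = \<bar>\<zeta>\<bar>\<^sup>2 p\<^sub>v \<zeta>\<close>, the positivity that defines the class \<open>\<M>\<close>
  yields \<open>Re p\<^sub>v > 0\<close> away from \<open>0\<close> (\<open>slice_fun_in_caratheodory_class\<close>).

  Grouping the expansion of \<open>G\<close> by total degree identifies the Taylor coefficients of \<open>p\<^sub>v\<close>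
  (\<open>slice_fun_has_fps_expansion\<close>). The multi-index series is only known to
  converge near the origin, so the grouping is confined to a neighbourhood of it, but the Taylor series of a holomorphic function on the disc
  converges to it on the whole disc. Hence the one-variable series represents \<open>p\<^sub>v\<close> on the whole disc.

  The estimate is Caratheodory's coefficient bound
  (\<open>taylor_coeff_bound_of_Re_nonneg\<close>), applied to each \<open>p\<^sub>v\<close>.
\<close>

section \<open>Coefficients of functions with nonnegative real part\<close>

lemma taylor_coeff_circle_mean:
  assumes hol: "f holomorphic_on ball 0 R" and r: "0 < r" "r < R"
  shows "((\<lambda>t. f (circlepath 0 r t) / circlepath 0 r t ^ k) has_integral
           (deriv ^^ k) f 0 / fact k) {0..1}"
proof -
  define c where "c = complex_of_real (2 * pi) * \<i>"
  have c: "c \<noteq> 0"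
    by (simp add: c_def)
  have \<gamma>_nz: "circlepath 0 r t \<noteq> 0" for t
    using r by (simp add: circlepath)
  have d\<gamma>: "vector_derivative (circlepath 0 r) (at t within {0..1}) = c * circlepath 0 r t"
    if "t \<in> {0..1}" for t
    using that by (simp add: vector_derivative_circlepath01 c_def) (simp add: circlepath)
  have "((\<lambda>u. f u / (u - 0) ^ Suc k) has_contour_integral c / fact k * (deriv ^^ k) f 0)
          (circlepath 0 r)"
    unfolding c_def using r
    by (intro Cauchy_has_contour_integral_higher_derivative_circlepath
        holomorphic_on_imp_continuous_on holomorphic_on_subset[OF hol]) auto
  then have "((\<lambda>t. f (circlepath 0 r t) / circlepath 0 r t ^ Suc k *
               vector_derivative (circlepath 0 r) (at t within {0..1})) has_integral
             c / fact k * (deriv ^^ k) f 0) {0..1}"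
    by (simp add: has_contour_integral_def)
  from has_integral_mult_right[OF this, of "1 / c"]
  have "((\<lambda>t. f (circlepath 0 r t) / circlepath 0 r t ^ k) has_integral
           1 / c * (c / fact k * (deriv ^^ k) f 0)) {0..1}"
    by (rule has_integral_eq[rotated]) (simp add: d\<gamma> c \<gamma>_nz)
  then show ?thesis
    by (simp add: c)
qed

text \<open>On a circle of radius \<open>r < 1\<close>, the coefficient \<open>a\<^sub>k\<close> is the mean of \<open>f / \<gamma>\<^sup>k\<close>, while the mean of
  \<open>f \<gamma>\<^sup>k\<close> vanishes because \<open>f z * z ^ k\<close> vanishes at \<open>0\<close>. Conjugation turns the
  second mean into that of \<open>cnj f / \<gamma>\<^sup>k\<close>, so \<open>a\<^sub>k\<close> is also the mean of \<open>2 Re f / \<gamma>\<^sup>k\<close>. The modulus of this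
  integrand is \<open>2 Re f / r\<^sup>k\<close>, whose mean is \<open>2 Re (f 0) / r\<^sup>k\<close>; then let \<open>r\<close> tend to \<open>1\<close>.\<close>

lemma taylor_coeff_bound_of_Re_nonneg:
  assumes hol: "f holomorphic_on ball 0 1"
    and Re_f: "\<And>z. z \<in> ball 0 1 \<Longrightarrow> 0 \<le> Re (f z)"
    and k: "k \<ge> 1"
  shows "cmod ((deriv ^^ k) f 0 / fact k) \<le> 2 * Re (f 0)"
proof -
  define a where "a = (deriv ^^ k) f 0 / fact k"
  have bound: "cmod a * r ^ k \<le> 2 * Re (f 0)" if r: "0 < r" "r < 1" for r
  proof -
    define \<gamma> where "\<gamma> = circlepath 0 r"
    have nz: "\<gamma> t \<noteq> 0" and in_disc: "\<gamma> t \<in> ball 0 1" and cnj_\<gamma>: "cnj (\<gamma> t) = r\<^sup>2 / \<gamma> t"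
      and norm_\<gamma>: "cmod (\<gamma> t) = r" for t
      using r by (auto simp: \<gamma>_def circlepath norm_mult exp_cnj power2_eq_square divide_simps
          simp flip: exp_add)
    have pos: "((\<lambda>t. f (\<gamma> t) / \<gamma> t ^ k) has_integral a) {0..1}"
      unfolding a_def \<gamma>_def by (rule taylor_coeff_circle_mean[OF hol r])
    have "((\<lambda>t. f (\<gamma> t) * \<gamma> t ^ k) has_integral 0) {0..1}"
      using taylor_coeff_circle_mean[of "\<lambda>z. f z * z ^ k" 1 r 0] holomorphic_on_mult[OF hol, of "\<lambda>z. z ^ k"] r k
      by (simp add: \<gamma>_def zero_power holomorphic_on_power)
    from has_integral_mult_right[OF iffD2[OF has_integral_cnj this], of "1 / r ^ (2 * k)"]
    have neg: "((\<lambda>t. cnj (f (\<gamma> t)) / \<gamma> t ^ k) has_integral 0) {0..1}"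
      using r nz by (simp add: o_def cnj_\<gamma> power_divide power_mult)
    have coeff: "((\<lambda>t. of_real (2 * Re (f (\<gamma> t))) / \<gamma> t ^ k) has_integral a) {0..1}"
      using has_integral_add[OF pos neg] by (simp add: complex_add_cnj flip: add_divide_distrib)
    have "((\<lambda>t. f (\<gamma> t)) has_integral f 0) {0..1}"
      using taylor_coeff_circle_mean[OF hol r, of 0] by (simp add: \<gamma>_def)
    from has_integral_mult_right[OF has_integral_Re[OF this], of "2 / r ^ k"]
    have mean: "((\<lambda>t. 2 * Re (f (\<gamma> t)) / r ^ k) has_integral 2 * Re (f 0) / r ^ k) {0..1}"
      by simp
    have "cmod a \<le> 2 * Re (f 0) / r ^ k"
      unfolding integral_unique[OF coeff, symmetric] integral_unique[OF mean, symmetric]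
      by (rule integral_norm_bound_integral)
         (use coeff mean Re_f in_disc r in \<open>auto simp: norm_divide norm_power norm_\<gamma> norm_mult has_integral_iff\<close>)
    then show ?thesis
      using r by (simp add: field_simps)
  qed
  have "((\<lambda>r. cmod a * r ^ k) \<longlongrightarrow> cmod a * 1 ^ k) (at_left 1)"
    by (intro tendsto_intros)
  moreover have "\<forall>\<^sub>F r in at_left 1. cmod a * r ^ k \<le> 2 * Re (f 0)"
    using eventually_at_left_real[of 0 1] by (rule eventually_mono) (auto intro: bound)
  ultimately show ?thesis
    unfolding a_def[symmetric] by (auto dest: tendsto_upperbound)
qed

section \<open>Restriction to complex lines\<close>

lemma norm_smult2: "norm (c *s (v :: complex ^ 2)) = cmod c * norm v"
  by (simp add: norm_vec_def L2_set_def sum_2 norm_mult power_mult_distrib real_sqrt_mult flip: distrib_left)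

lemma cinner2_self: "cinner2 v v = of_real ((norm v)\<^sup>2)"
  by (simp add: cinner2_def norm_vec_def L2_set_def sum_2 flip: complex_norm_square)

lemma bounded_linear_complex_line: "bounded_linear (\<lambda>\<xi>. \<xi> *s (v :: complex ^ 2))"
  by (rule bounded_linear_intro[where K = "norm v"])
     (auto simp: vec_eq_iff algebra_simps norm_smult2)

text \<open>Complex linearity of the Frechet derivative is what makes the slice complex differentiable;
  the conjugation in the inner product is harmless since it only affects the fixed \<open>v\<close>.\<close>

lemma has_field_derivative_slice:
  fixes v :: "complex ^ 2"
  assumes D: "(h has_derivative D) (at (\<zeta> *s v))" and lin: "\<And>c x. D (c *s x) = c *s D x"
  shows "((\<lambda>\<xi>. cinner2 (h (\<xi> *s v)) v) has_field_derivative cinner2 (D v) v) (at \<zeta>)"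
proof -
  have "((\<lambda>\<xi>. \<xi> *s v) has_derivative (\<lambda>\<xi>. \<xi> *s v)) (at \<zeta>)"
    by (rule bounded_linear_imp_has_derivative[OF bounded_linear_complex_line])
  from has_derivative_compose[OF this D]
  have "((\<lambda>\<xi>. h (\<xi> *s v)) has_derivative (\<lambda>\<xi>. \<xi> *s D v)) (at \<zeta>)"
    by (simp add: lin)
  moreover have "bounded_linear (\<lambda>z. cinner2 z v)"
    unfolding cinner2_def
    by (intro bounded_linear_add bounded_linear_mult_const bounded_linear_vec_nth)
  ultimately have "((\<lambda>\<xi>. cinner2 (h (\<xi> *s v)) v) has_derivative (\<lambda>\<xi>. cinner2 (\<xi> *s D v) v)) (at \<zeta>)"
    by (rule bounded_linear.has_derivative[rotated])
  then show ?thesis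
    unfolding has_field_derivative_def
    by (rule has_derivative_eq_rhs) (simp add: fun_eq_iff cinner2_def algebra_simps)
qed

text \<open>Unconditional summability permits summing over the finite sets of multi-indices of equal degree
  first; on each of them the monomials scale by the same power of \<open>\<zeta>\<close>.\<close>

lemma has_sum_homogeneous_parts:
  assumes "((\<lambda>\<alpha>. a \<alpha> * mi_pow (\<zeta> *s v) \<alpha>) has_sum S) {\<alpha>. k \<le> mi_deg \<alpha>}"
  shows "(\<lambda>n. (\<Sum>\<alpha> | mi_deg \<alpha> = n + k. a \<alpha> * mi_pow v \<alpha>) * \<zeta> ^ (n + k)) sums S"
proof (rule has_sum_imp_sums, rule has_sum_SigmaD)
  have "((\<lambda>(n, \<alpha>). a \<alpha> * mi_pow (\<zeta> *s v) \<alpha>) has_sum S) (SIGMA n:UNIV. {\<alpha>. mi_deg \<alpha> = n + k}) \<longleftrightarrow>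
        ((\<lambda>\<alpha>. a \<alpha> * mi_pow (\<zeta> *s v) \<alpha>) has_sum S) {\<alpha>. k \<le> mi_deg \<alpha>}"
    by (rule has_sum_reindex_bij_witness[of _ "\<lambda>\<alpha>. (mi_deg \<alpha> - k, \<alpha>)" snd]) auto
  with assms show "((\<lambda>(n, \<alpha>). a \<alpha> * mi_pow (\<zeta> *s v) \<alpha>) has_sum S) (SIGMA n:UNIV. {\<alpha>. mi_deg \<alpha> = n + k})"
    by simp
  have "mi_pow (\<zeta> *s v) \<alpha> = mi_pow v \<alpha> * \<zeta> ^ mi_deg \<alpha>" for \<alpha>
    by (simp add: mi_pow_def mi_deg_def power_mult_distrib power_add mult_ac)
  then show "((\<lambda>\<alpha>. case (n, \<alpha>) of (n, \<alpha>) \<Rightarrow> a \<alpha> * mi_pow (\<zeta> *s v) \<alpha>) has_sum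
          (\<Sum>\<alpha> | mi_deg \<alpha> = n + k. a \<alpha> * mi_pow v \<alpha>) * \<zeta> ^ (n + k)) {\<alpha>. mi_deg \<alpha> = n + k}" for n
    by (intro has_sum_finiteI finite_mi_deg_eq) (simp add: sum_distrib_left sum_distrib_right mult_ac)
qed

section \<open>The slice functions of a Herglotz vector field\<close>

text \<open>The value of \<open>slice_fun\<close> at \<open>0\<close> is the limit of the difference quotients of \<open>g\<close>, where
  \<open>g \<zeta> = - \<langle>G (\<zeta> v), v\<rangle>\<close>; this limit is \<open>g' 0\<close>, so holomorphy at \<open>0\<close> comes from the removable singularity of \<open>g \<zeta> / \<zeta>\<close>.\<close>

lemma slice_fun_in_caratheodory_class:
  assumes G: "autonomous_herglotz G" and v: "norm v = 1"
  shows "slice_fun G v \<in> caratheodory_class"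
proof -
  define h where "h = (\<lambda>z. - G z)"
  define g where "g = (\<lambda>\<zeta>. cinner2 (h (\<zeta> *s v)) v)"
  from G have hol_h: "holomorphic_map_on h unit_ball2" and h0: "h 0 = 0"
    and dh0: "(h has_derivative id) (at 0)"
    and Re_h: "\<And>z. z \<in> unit_ball2 - {0} \<Longrightarrow> 0 < Re (cinner2 (h z) z)"
    by (auto simp: autonomous_herglotz_def class_M_def h_def)
  have in_ball: "\<zeta> *s v \<in> unit_ball2" if "\<zeta> \<in> unit_disc" for \<zeta>
    using that v by (simp add: norm_smult2)
  have "g field_differentiable at \<zeta>" if "\<zeta> \<in> unit_disc" for \<zeta>
    using hol_h in_ball[OF that] has_field_derivative_slice[of h _ \<zeta> v]
    unfolding g_def holomorphic_map_on_def field_differentiable_def by blast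
  then have hol_g: "g holomorphic_on unit_disc"
    by (simp add: holomorphic_on_def field_differentiable_at_within)
  have "(h has_derivative id) (at (0 *s v))"
    using dh0 by (simp only: vector_smult_lzero)
  then have "(g has_field_derivative cinner2 (id v) v) (at 0)"
    unfolding g_def by (rule has_field_derivative_slice) simp
  then have dg: "(g has_field_derivative 1) (at 0)"
    using v by (simp add: cinner2_self)
  have g0: "g 0 = 0"
    by (simp add: g_def h0 cinner2_def)
  have slice: "slice_fun G v \<zeta> = (if \<zeta> = 0 then 1 else g \<zeta> / \<zeta>)" for \<zeta>
  proof -
    have g_eq: "g \<xi> = - cinner2 (G (\<xi> *s v)) v" for \<xi>
      by (simp add: g_def h_def cinner2_def)
    have "((\<lambda>\<xi>. g \<xi> / \<xi>) \<longlongrightarrow> 1) (at 0)"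
      using dg by (simp add: has_field_derivative_iff g0)
    then show ?thesis
      by (simp add: slice_fun_def g_eq tendsto_Lim)
  qed
  have "(\<lambda>\<zeta>. if \<zeta> = 0 then deriv g 0 else (g \<zeta> - g 0) / (\<zeta> - 0)) holomorphic_on unit_disc"
    by (rule pole_lemma_open[OF hol_g]) simp
  then have "slice_fun G v holomorphic_on unit_disc"
    by (rule holomorphic_transform) (simp add: slice g0 DERIV_imp_deriv[OF dg])
  moreover have "0 < Re (slice_fun G v \<zeta>)" if \<zeta>: "\<zeta> \<in> unit_disc" for \<zeta>
  proof (cases "\<zeta> = 0")
    case False
    have "\<zeta> *s v \<noteq> 0"
      using False v norm_smult2[of \<zeta> v] by auto
    then have "0 < Re (cinner2 (h (\<zeta> *s v)) (\<zeta> *s v))"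
      using Re_h in_ball[OF \<zeta>] by simp
    also have "cinner2 (h (\<zeta> *s v)) (\<zeta> *s v) = cnj \<zeta> * g \<zeta>"
      by (simp add: g_def cinner2_def algebra_simps)
    also have "\<dots> = of_real ((cmod \<zeta>)\<^sup>2) * slice_fun G v \<zeta>"
      using False by (simp add: slice complex_norm_square del: of_real_power)
    finally show ?thesis
      using False by (simp add: zero_less_mult_iff del: of_real_power)
  qed (simp add: slice)
  ultimately show ?thesis
    by (simp add: caratheodory_class_def slice)
qed

text \<open>Pairing the expansion of \<open>G\<close> with \<open>v\<close> gives
  \<open>\<langle>G (\<zeta> v), v\<rangle> + \<zeta> = \<Sum>\<^sub>m c\<^sub>m \<zeta>\<^bsup>m+1\<^esup>\<close> near \<open>0\<close>,
  where \<open>m \<ge> 1\<close> and \<open>c\<^sub>m\<close> is the slice coefficient, and division by \<open>- \<zeta>\<close> lowers every exponent by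
  one. At \<open>\<zeta> = 0\<close> this division says nothing, whence the separate hypothesis on the value
  there.\<close>

lemma slice_fun_has_fps_expansion:
  assumes exp: "herglotz_expansion G q1 q2" and v: "norm v = 1" and p0: "slice_fun G v 0 = 1"
  shows "slice_fun G v has_fps_expansion
           Abs_fps (\<lambda>m. if m = 0 then 1 else - slice_coeff q1 q2 v m)"
proof (rule has_fps_expansionI)
  have "((\<lambda>\<zeta>. \<zeta> *s v) \<longlongrightarrow> 0 *s v) (nhds 0)"
    by (rule bounded_linear.tendsto[OF bounded_linear_complex_line filterlim_ident])
  then have "filterlim (\<lambda>\<zeta>. \<zeta> *s v) (nhds 0) (nhds 0)"
    by simp
  from eventually_compose_filterlim[OF exp[unfolded herglotz_expansion_def] this]
  show "\<forall>\<^sub>F \<zeta> in nhds 0. (\<lambda>m. fps_nth (Abs_fps (\<lambda>m. if m = 0 then 1 else - slice_coeff q1 q2 v m)) m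
          * \<zeta> ^ m) sums slice_fun G v \<zeta>"
  proof (rule eventually_mono, elim conjE)
    fix \<zeta>
    let ?z = "\<zeta> *s v" and ?A = "{\<alpha>. 2 \<le> mi_deg \<alpha>}"
    let ?s1 = "\<Sum>\<^sub>\<infinity>\<alpha>\<in>?A. q1 \<alpha> * mi_pow ?z \<alpha>" and ?s2 = "\<Sum>\<^sub>\<infinity>\<alpha>\<in>?A. q2 \<alpha> * mi_pow ?z \<alpha>"
    assume sum1: "(\<lambda>\<alpha>. q1 \<alpha> * mi_pow ?z \<alpha>) summable_on ?A"
      and sum2: "(\<lambda>\<alpha>. q2 \<alpha> * mi_pow ?z \<alpha>) summable_on ?A"
      and G1: "G ?z $ 1 = - ?z $ 1 + ?s1" and G2: "G ?z $ 2 = - ?z $ 2 + ?s2"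
    have "((\<lambda>\<alpha>. (q1 \<alpha> * cnj (v $ 1) + q2 \<alpha> * cnj (v $ 2)) * mi_pow ?z \<alpha>) has_sum
            ?s1 * cnj (v $ 1) + ?s2 * cnj (v $ 2)) ?A"
      using has_sum_add[OF has_sum_cmult_left[OF has_sum_infsum[OF sum1], of "cnj (v $ 1)"]
          has_sum_cmult_left[OF has_sum_infsum[OF sum2], of "cnj (v $ 2)"]]
      by (simp add: algebra_simps)
    also have "?s1 * cnj (v $ 1) + ?s2 * cnj (v $ 2) = cinner2 (G ?z) v + \<zeta> * cinner2 v v"
      by (simp add: cinner2_def G1 G2 algebra_simps)
    finally have "(\<lambda>m. slice_coeff q1 q2 v (Suc m) * \<zeta> ^ (m + 2)) sums (cinner2 (G ?z) v + \<zeta>)"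
      using v by (auto dest!: has_sum_homogeneous_parts simp: slice_coeff_def cinner2_self)
    from sums_divide[OF this, of "- \<zeta>"]
    have "(\<lambda>m. - slice_coeff q1 q2 v (Suc m) * \<zeta> ^ Suc m) sums (slice_fun G v \<zeta> - 1)"
      by (cases "\<zeta> = 0") (simp add: p0, auto simp: slice_fun_def add_divide_distrib)
    then have "(\<lambda>m. (if m = 0 then 1 else - slice_coeff q1 q2 v m) * \<zeta> ^ m) sums slice_fun G v \<zeta>"
      using sums_Suc_iff[of "\<lambda>m. (if m = 0 then 1 else - slice_coeff q1 q2 v m) * \<zeta> ^ m"
          "slice_fun G v \<zeta> - 1"] by simp
    then show "(\<lambda>m. fps_nth (Abs_fps (\<lambda>m. if m = 0 then 1 else - slice_coeff q1 q2 v m)) m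
          * \<zeta> ^ m) sums slice_fun G v \<zeta>"
      by simp
  qed
qed

theorem mainTheorem2:
  fixes G :: "complex ^ 2 \<Rightarrow> complex ^ 2"
    and q1 q2 :: "nat \<times> nat \<Rightarrow> complex"
  assumes "autonomous_herglotz G"
    and "herglotz_expansion G q1 q2"
  shows "(\<forall>v. norm v = 1 \<longrightarrow>
            slice_fun G v \<in> caratheodory_class \<and>
            (\<forall>\<zeta>\<in>unit_disc.
               summable (\<lambda>m. slice_coeff q1 q2 v (Suc m) * \<zeta> ^ Suc m) \<and>
               slice_fun G v \<zeta> = 1 - (\<Sum>m. slice_coeff q1 q2 v (Suc m) * \<zeta> ^ Suc m)))
       \<and> (\<forall>m\<ge>1.
            bdd_above ((\<lambda>v. cmod (slice_coeff q1 q2 v m)) ` {v. norm v = 1}) \<and>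
            (SUP v\<in>{v. norm v = 1}. cmod (slice_coeff q1 q2 v m)) \<le> 2)"
proof -
  define c where "c = slice_coeff q1 q2"
  have p: "slice_fun G v \<in> caratheodory_class" if "norm v = 1" for v
    by (rule slice_fun_in_caratheodory_class[OF assms(1) that])
  have hol: "slice_fun G v holomorphic_on unit_disc" and p0: "slice_fun G v 0 = 1"
    and Re_p: "\<And>\<zeta>. \<zeta> \<in> unit_disc \<Longrightarrow> 0 < Re (slice_fun G v \<zeta>)" if "norm v = 1" for v
    using p[OF that] by (auto simp: caratheodory_class_def)
  have taylor: "(deriv ^^ m) (slice_fun G v) 0 / fact m = (if m = 0 then 1 else - c v m)"
    if v: "norm v = 1" for v m
    using fps_nth_fps_expansion[OF slice_fun_has_fps_expansion[OF assms(2) v p0[OF v]], of m, symmetric]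
    by (simp only: c_def fps_nth_Abs_fps)
  have expansion: "(\<lambda>m. c v (Suc m) * \<zeta> ^ Suc m) sums (1 - slice_fun G v \<zeta>)"
    if v: "norm v = 1" and \<zeta>: "\<zeta> \<in> unit_disc" for v \<zeta>
  proof -
    have "(\<lambda>m. (if m = 0 then 1 else - c v m) * \<zeta> ^ m) sums slice_fun G v \<zeta>"
      using holomorphic_power_series[OF hol[OF v] \<zeta>] by (simp only: taylor[OF v] diff_0_right)
    then have "(\<lambda>m. - (c v (Suc m) * \<zeta> ^ Suc m)) sums (slice_fun G v \<zeta> - 1)"
      using sums_Suc_iff[of "\<lambda>m. (if m = 0 then 1 else - c v m) * \<zeta> ^ m" "slice_fun G v \<zeta> - 1"]
      by simp
    from sums_minus[OF this] show ?thesis by simp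
  qed
  have bound: "cmod (c v m) \<le> 2" if v: "norm v = 1" and m: "m \<ge> 1" for v m
    using taylor_coeff_bound_of_Re_nonneg[OF hol[OF v] less_imp_le[OF Re_p[OF v]] m] m
    by (simp add: taylor[OF v] p0[OF v])
  have "axis 1 1 \<in> {v :: complex ^ 2. norm v = 1}"
    by simp
  then have "{v :: complex ^ 2. norm v = 1} \<noteq> {}"
    by blast
  then have "bdd_above ((\<lambda>v. cmod (c v m)) ` {v. norm v = 1}) \<and> (SUP v\<in>{v. norm v = 1}. cmod (c v m)) \<le> 2"
    if "m \<ge> 1" for m
    using bound that by (intro conjI bdd_aboveI[of _ 2] cSUP_least) auto
  moreover have "summable (\<lambda>m. c v (Suc m) * \<zeta> ^ Suc m) \<and>
      slice_fun G v \<zeta> = 1 - (\<Sum>m. c v (Suc m) * \<zeta> ^ Suc m)"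
    if "norm v = 1" "\<zeta> \<in> unit_disc" for v \<zeta>
    using sums_summable[OF expansion[OF that]] sums_unique[OF expansion[OF that]]
    by (simp add: algebra_simps)
  ultimately show ?thesis
    using p unfolding c_def by (intro conjI allI impI ballI) simp_all
qed

end
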